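(* Let $x,y,\mu:M\to\mathbb C$ be smooth with $x\neq y$ everywhere, $W=W(x(w),y(w))$, $|\mu|^2\langle W,\overline W\rangle^{\mathbb C}=2$, let $$f=\frac{\mu W+\bar\mu\,\overline W}{2},\qquad \nu=\frac{\mu W-\bar\mu\,\overline W}{2i},$$ and suppose that $$\frac{\mu_w}{\mu}=-\frac{\langle W_w,\overline W\rangle^{\mathbb C}}{\langle W,\overline W\rangle^{\mathbb C}},\qquad \frac{\mu_{\bar w}}{\mu}=-\frac{\langle W_{\bar w},\overline W\rangle^{\mathbb C}}{\langle W,\overline W\rangle^{\mathbb C}}.$$ Then $(M,f)$ is a parametric isotropic surface of $\mathbb S^3_1(1)$ with Gauss map $(M,\nu)$ if and only if the following equations are satisfied: $$\operatorname{Im}\big(\mu\langle W_w,L(y)\rangle^{\mathbb C}+\bar\mu\langle\overline W_w,L(y)\rangle^{\mathbb C}\big)=0,\qquad \operatorname{Re}\big(\mu\langle W_w,L(x)\rangle^{\mathbb C}+\bar\mu\langle\overline W_w,L(x)\rangle^{\mathbb C}\big)=0 .$$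
   Context: $\mathbb R^4_1$ is $\mathbb R^4$ with $\langle p,q\rangle=-p^1q^1+p^2q^2+p^3q^3+p^4q^4$, oriented by its canonical basis and time-oriented by the first basis vector; $\mathbb S^3_1(1)=\{p:\langle p,p\rangle=1\}$; $\langle\cdot,\cdot\rangle^{\mathbb C}$ is the complex bilinear extension to $\mathbb C^4$. $M\subset\mathbb C$ is open, connected and simply connected, $w=u+iv$, $\partial_w=\frac12(\partial_u-i\partial_v)$, $\partial_{\bar w}=\frac12(\partial_u+i\partial_v)$; $\overline W_w=\partial_w(\overline W)$. For $x\neq y$ in $\mathbb C$: $L(x)=(1+x\bar x,x+\bar x,-i(x-\bar x),-1+x\bar x)$ and $W(x,y)=(1+x\bar y,x+\bar y,-i(x-\bar y),-1+x\bar y)$. $(M,f)$ is a parametric isotropic surface of $\mathbb S^3_1(1)$ when $f:M\to\mathbb R^4_1$ is smooth, is a homeomorphism onto its image, has $f_u,f_v$ linearly independent at each point, satisfies $\langle f,f\rangle=1$, and $(u,v)$ are null coordinates, i.e. the induced metric is Lorentzian of the form $2F\,du\,dv$ with $F=\langle f_u,f_v\rangle$; the lightlike vectors $f_u,f_v$ are taken future directed, so $F<0$. Its Gauss map is the map $\nu$ with $\langle\nu,\nu\rangle=1$, $\langle\nu,f\rangle=\langle\nu,f_u\rangle=\langle\nu,f_v\rangle=0$, and $\{f,f_u,f_v,\nu\}$ a positively oriented basis of $\mathbb R^4_1$ at each point; it is assumed throughout to be non-constant. Standing convention: $x$ and $y$ are the stereographic projections of the null tangent directions, $x=st(f_u)$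 and $y=st(f_v)$, where $st(\ell)=\dfrac{\ell^2+i\ell^3}{\ell^1-\ell^4}$ for a future directed lightlike vector $\ell=(\ell^1,\ell^2,\ell^3,\ell^4)$; thus $f_u=\alpha L(x)$ and $f_v=\beta L(y)$ with $\alpha,\beta$ real-valued functions.
   Formalization: Added hypotheses: f is a homeomorphism onto its image and f_u, f_v are future directed; without them the "if" direction fails (e.g. non-injective or constant f). The convention x=st(f_u), y=st(f_v) is part of the left-hand side of the equivalence. *)

theory Defs
  imports "HOL-Analysis.Analysis"
begin

(* C^k on an open set, for maps between real normed spaces.  Maps on the complex plane are
   differentiated as maps of two real variables. *)
primrec Ck_on ::
  "nat \<Rightarrow> 'a::real_normed_vector set \<Rightarrow> ('a \<Rightarrow> 'b::real_normed_vector) \<Rightarrow> bool" where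
  "Ck_on 0 S h \<longleftrightarrow> continuous_on S h"
| "Ck_on (Suc k) S h \<longleftrightarrow>
     (\<forall>p\<in>S. h differentiable (at p)) \<and>
     (\<forall>d. Ck_on k S (\<lambda>p. frechet_derivative h (at p) d))"

definition smooth_on ::
  "'a::real_normed_vector set \<Rightarrow> ('a \<Rightarrow> 'b::real_normed_vector) \<Rightarrow> bool" where
  "smooth_on S h \<longleftrightarrow> (\<forall>k. Ck_on k S h)"

definition du :: "(complex \<Rightarrow> 'b::real_normed_vector) \<Rightarrow> complex \<Rightarrow> 'b" where
  "du h w = frechet_derivative h (at w) 1"

definition dv :: "(complex \<Rightarrow> 'b::real_normed_vector) \<Rightarrow> complex \<Rightarrow> 'b" where
  "dv h w = frechet_derivative h (at w) \<i>"

definition dw :: "(complex \<Rightarrow> complex) \<Rightarrow> complex \<Rightarrow> complex" where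
  "dw h w = (du h w - \<i> * dv h w) / 2"

definition dwbar :: "(complex \<Rightarrow> complex) \<Rightarrow> complex \<Rightarrow> complex" where
  "dwbar h w = (du h w + \<i> * dv h w) / 2"

definition dw_vec :: "(complex \<Rightarrow> complex^4) \<Rightarrow> complex \<Rightarrow> complex^4" where
  "dw_vec H w = (\<chi> k. dw (\<lambda>z. H z $ k) w)"

definition dwbar_vec :: "(complex \<Rightarrow> complex^4) \<Rightarrow> complex \<Rightarrow> complex^4" where
  "dwbar_vec H w = (\<chi> k. dwbar (\<lambda>z. H z $ k) w)"

(* On real^4 this is the Lorentzian product, on complex^4 its complex bilinear extension. *)
definition mink :: "'a::comm_ring_1^4 \<Rightarrow> 'a^4 \<Rightarrow> 'a" where
  "mink p q = - (p$1 * q$1) + p$2 * q$2 + p$3 * q$3 + p$4 * q$4"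

definition cvec :: "real^4 \<Rightarrow> complex^4" where
  "cvec p = (\<chi> k. complex_of_real (p $ k))"

definition cnj_vec :: "complex^4 \<Rightarrow> complex^4" where
  "cnj_vec z = (\<chi> k. cnj (z $ k))"

definition Wvec :: "complex \<Rightarrow> complex \<Rightarrow> complex^4" where
  "Wvec x y = vector [1 + x * cnj y, x + cnj y, - \<i> * (x - cnj y), - 1 + x * cnj y]"

(* The entries are real; the vector is only used as an argument of the complex bilinear form. *)
definition Lvec :: "complex \<Rightarrow> complex^4" where
  "Lvec x = vector [1 + x * cnj x, x + cnj x, - \<i> * (x - cnj x), - 1 + x * cnj x]"

definition lightlike :: "real^4 \<Rightarrow> bool" where
  "lightlike l \<longleftrightarrow> l \<noteq> 0 \<and> mink l l = 0"

(* Same side as the first basis vector e1, i.e. mink l e1 < 0. *)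
definition future_directed :: "real^4 \<Rightarrow> bool" where
  "future_directed l \<longleftrightarrow> 0 < l $ 1"

(* Meaningful only for l$1 \<noteq> l$4: the lightlike vectors with l$1 = l$4 are the multiples of
   (1,0,0,1), which project to infinity. *)
definition st :: "real^4 \<Rightarrow> complex" where
  "st l = Complex (l$2) (l$3) / complex_of_real (l$1 - l$4)"

definition homeo_onto_image :: "complex set \<Rightarrow> (complex \<Rightarrow> real^4) \<Rightarrow> bool" where
  "homeo_onto_image M f \<longleftrightarrow> (\<exists>g. homeomorphism M (f ` M) f g)"

(* The inequality f_u \<noteq> f_v is needed since independence of the set {f_u, f_v} does not see
   a repeated vector. *)
definition isotropic_surface :: "complex set \<Rightarrow> (complex \<Rightarrow> real^4) \<Rightarrow> bool" where
  "isotropic_surface M f \<longleftrightarrow>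
     smooth_on M f \<and>
     homeo_onto_image M f \<and>
     (\<forall>w\<in>M.
        du f w \<noteq> dv f w \<and> independent {du f w, dv f w} \<and>
        mink (f w) (f w) = 1 \<and>
        lightlike (du f w) \<and> lightlike (dv f w) \<and>
        future_directed (du f w) \<and> future_directed (dv f w) \<and>
        mink (du f w) (dv f w) < 0)"

(* A quadruple is a positively oriented basis iff its determinant is positive; taking the
   vectors as rows rather than columns does not change the determinant. *)
definition gauss_map ::
  "complex set \<Rightarrow> (complex \<Rightarrow> real^4) \<Rightarrow> (complex \<Rightarrow> real^4) \<Rightarrow> bool" where
  "gauss_map M f \<nu> \<longleftrightarrow>
     (\<forall>w\<in>M.
        mink (\<nu> w) (\<nu> w) = 1 \<and>
        mink (\<nu> w) (f w) = 0 \<and> mink (\<nu> w) (du f w) = 0 \<and> mink (\<nu> w) (dv f w) = 0 \<and>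
        det (vector [f w, du f w, dv f w, \<nu> w] :: real^4^4) > 0)"

(* x and y are the (finite) stereographic projections of the null directions f_u and f_v. *)
definition null_directions ::
  "complex set \<Rightarrow> (complex \<Rightarrow> real^4) \<Rightarrow> (complex \<Rightarrow> complex) \<Rightarrow> (complex \<Rightarrow> complex) \<Rightarrow> bool" where
  "null_directions M f x y \<longleftrightarrow>
     (\<forall>w\<in>M.
        du f w $ 1 \<noteq> du f w $ 4 \<and> x w = st (du f w) \<and>
        dv f w $ 1 \<noteq> dv f w $ 4 \<and> y w = st (dv f w))"

end

theory Submission
  imports Defs
begin

text \<open>Write \<open>Z = \<mu> W = f + \<i> \<nu>\<close> and \<open>L(x)\<close>, \<open>L(y)\<close> for the null vectors of the two directions. The
  Lorentzian product of two vectors \<open>Wvec a b\<close> and \<open>Wvec c d\<close> factors as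
  \<open>- 2 (a - c) (cnj b - cnj d)\<close> (lemma \<open>mink_Wvec\<close>). With the normalisation of \<open>\<mu>\<close>, this makes
  \<open>f\<close> and \<open>\<nu>\<close> orthonormal spacelike vectors spanning the orthogonal complement of the
  Lorentzian plane spanned by \<open>L(x)\<close> and \<open>L(y)\<close> (lemma \<open>scaled_Wvec_frame_products\<close>).

  Since \<open>W\<close> is affine in \<open>x\<close> and in \<open>cnj y\<close> separately, its derivative is a
  combination of \<open>W\<close>, \<open>L(x)\<close> and \<open>L(y)\<close>. The equations for the logarithmic derivatives of
  \<open>\<mu>\<close> say that the derivative of \<open>Z\<close> has no \<open>W\<close>-component, so \<open>f\<^sub>u\<close> and \<open>f\<^sub>v\<close> are real
  combinations \<open>f\<^sub>u = p L(x) + q L(y)\<close> and \<open>f\<^sub>v = r L(x) + s L(y)\<close>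
  (lemma \<open>null_frame_coefficients\<close>). In particular \<open>\<nu>\<close> is always normal to \<open>f\<close>.

  The products of \<open>L(x)\<close> and \<open>L(y)\<close> with \<open>W\<close> vanish, so the two expressions of the criterion are
  \<open>2 \<langle>f\<^sub>w, L(y)\<rangle>\<close> and \<open>2 \<langle>f\<^sub>w, L(x)\<rangle>\<close>, where \<open>2 f\<^sub>w = f\<^sub>u - \<i> f\<^sub>v\<close>. As \<open>L(x)\<close> and \<open>L(y)\<close> are null
  and not orthogonal to each other, the imaginary part of the first detects \<open>r\<close> and the real part
  of the second detects \<open>q\<close>. Hence the equations say that \<open>f\<^sub>u\<close> is a multiple of \<open>L(x)\<close> and \<open>f\<^sub>v\<close> a
  multiple of \<open>L(y)\<close>, which is what the stereographic projections being \<open>x\<close> and \<open>y\<close> means for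
  lightlike vectors. Conversely the multiples are positive because \<open>f\<^sub>u\<close> and \<open>f\<^sub>v\<close> are future
  directed, and this gives both \<open>\<langle>f\<^sub>u, f\<^sub>v\<rangle> < 0\<close> and, through the determinant of
  \<open>f, L(x), L(y), \<nu>\<close> (lemma \<open>det_scaled_Wvec_frame\<close>), the orientation.\<close>

section \<open>Smooth maps on open sets\<close>

lemma Ck_on_cong:
  assumes "open S" "\<And>p. p \<in> S \<Longrightarrow> g p = h p" "Ck_on k S g"
  shows "Ck_on k S h"
  using assms(2,3)
proof (induction k arbitrary: g h)
  case 0
  then show ?case by (metis Ck_on.simps(1) continuous_on_eq)
next
  case (Suc k)
  have "h differentiable (at p)" if "p \<in> S" for p
    using Suc.prems that \<open>open S\<close>
    by (metis Ck_on.simps(2) differentiable_def has_derivative_transform_within_open)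
  moreover have "Ck_on k S (\<lambda>p. frechet_derivative h (at p) d)" for d
  proof (rule Suc.IH)
    show "frechet_derivative g (at p) d = frechet_derivative h (at p) d" if "p \<in> S" for p
      using frechet_derivative_transform_within_open[of g p S h] Suc.prems that \<open>open S\<close> by simp
    show "Ck_on k S (\<lambda>p. frechet_derivative g (at p) d)"
      using Suc.prems(2) by simp
  qed
  ultimately show ?case by simp
qed

text \<open>Introduction rule for the inductive closure proofs below: it suffices to exhibit a formula for
  the derivative on \<open>S\<close>, since on an open set \<open>Ck_on\<close> cannot see the values of that formula
  elsewhere.\<close>

lemma Ck_on_SucI:
  assumes "open S" "\<And>p. p \<in> S \<Longrightarrow> (h has_derivative h' p) (at p)"
    "\<And>d. Ck_on k S (\<lambda>p. h' p d)"
  shows "Ck_on (Suc k) S h"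
proof -
  have eq: "frechet_derivative h (at p) = h' p" if "p \<in> S" for p
    using frechet_derivative_at[OF assms(2)[OF that]] by simp
  have "Ck_on k S (\<lambda>p. frechet_derivative h (at p) d)" for d
    by (rule Ck_on_cong[OF assms(1) _ assms(3)[of d]]) (simp add: eq)
  then show ?thesis
    using assms(2) by (auto simp: differentiable_def)
qed

lemma Ck_on_Suc_imp:
  assumes "Ck_on (Suc k) S h"
  shows "Ck_on k S h"
  using assms
proof (induction k arbitrary: h)
  case 0
  then show ?case
    by (simp add: continuous_at_imp_continuous_on differentiable_imp_continuous_within)
next
  case (Suc k)
  then show ?case by (metis Ck_on.simps(2))
qed

lemma Ck_on_const: "Ck_on k S (\<lambda>p. c)"
  by (induction k arbitrary: c) (simp_all add: frechet_derivative_const)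

lemma Ck_on_bounded_linear:
  assumes "open S" "bounded_linear L" "Ck_on k S h"
  shows "Ck_on k S (\<lambda>p. L (h p))"
  using assms(3)
proof (induction k arbitrary: h)
  case 0
  then show ?case
    by (simp add: bounded_linear.continuous_on[OF assms(2)])
next
  case (Suc k)
  have D: "((\<lambda>p. L (h p)) has_derivative (\<lambda>d. L (frechet_derivative h (at p) d))) (at p)"
    if "p \<in> S" for p
    using Suc.prems that
    by (intro bounded_linear.has_derivative[OF assms(2)]) (simp flip: frechet_derivative_works)
  have "Ck_on k S (\<lambda>p. L (frechet_derivative h (at p) d))" for d
    using Suc.IH Suc.prems by simp
  with D show ?case by (rule Ck_on_SucI[OF assms(1)])
qed

lemma Ck_on_add:
  assumes "open S" "Ck_on k S g" "Ck_on k S h"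
  shows "Ck_on k S (\<lambda>p. g p + h p)"
  using assms(2,3)
proof (induction k arbitrary: g h)
  case 0
  then show ?case by (simp add: continuous_on_add)
next
  case (Suc k)
  have D: "((\<lambda>p. g p + h p) has_derivative
      (\<lambda>d. frechet_derivative g (at p) d + frechet_derivative h (at p) d)) (at p)"
    if "p \<in> S" for p
    using Suc.prems that by (intro has_derivative_add) (simp_all flip: frechet_derivative_works)
  have "Ck_on k S (\<lambda>p. frechet_derivative g (at p) d + frechet_derivative h (at p) d)" for d
    using Suc.IH Suc.prems by simp
  with D show ?case by (rule Ck_on_SucI[OF assms(1)])
qed

lemma Ck_on_mult:
  fixes g h :: "'a::real_normed_vector \<Rightarrow> 'b::real_normed_algebra"
  assumes "open S" "Ck_on k S g" "Ck_on k S h"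
  shows "Ck_on k S (\<lambda>p. g p * h p)"
  using assms(2,3)
proof (induction k arbitrary: g h)
  case 0
  then show ?case by (simp add: continuous_on_mult)
next
  case (Suc k)
  have D: "((\<lambda>p. g p * h p) has_derivative
      (\<lambda>d. g p * frechet_derivative h (at p) d + frechet_derivative g (at p) d * h p)) (at p)"
    if "p \<in> S" for p
    using Suc.prems that by (intro has_derivative_mult) (simp_all flip: frechet_derivative_works)
  have "Ck_on k S
      (\<lambda>p. g p * frechet_derivative h (at p) d + frechet_derivative g (at p) d * h p)" for d
    using Suc.prems Suc.prems[THEN Ck_on_Suc_imp]
    by (intro Ck_on_add[OF assms(1)] Suc.IH) simp_all
  with D show ?case by (rule Ck_on_SucI[OF assms(1)])
qed

lemma smooth_on_vec:
  fixes f :: "'a::real_normed_vector \<Rightarrow> real^'n"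
  assumes "open S" "\<And>i. smooth_on S (\<lambda>p. f p $ i)"
  shows "smooth_on S f"
proof -
  have "Ck_on k S (\<lambda>p. \<Sum>i\<in>I. f p $ i *\<^sub>R (axis i 1 :: real^'n))" if "finite I" for k and I :: "'n set"
    using that
  proof (induction I)
    case empty
    then show ?case by (simp add: Ck_on_const)
  next
    case (insert i I)
    have "Ck_on k S (\<lambda>p. f p $ i *\<^sub>R (axis i 1 :: real^'n))"
      using assms by (intro Ck_on_bounded_linear[OF assms(1) bounded_linear_scaleR_left])
        (simp add: smooth_on_def)
    then show ?case
      using insert by (simp add: Ck_on_add[OF assms(1)])
  qed
  moreover have "(\<Sum>i\<in>UNIV. f p $ i *\<^sub>R (axis i 1 :: real^'n)) = f p" for p
    using basis_expansion[of "f p"] by (simp add: scalar_mult_eq_scaleR)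
  ultimately show ?thesis
    unfolding smooth_on_def by (metis (no_types, lifting) finite_class.finite_UNIV  Ck_on_cong[OF assms(1)])
qed

section \<open>The Lorentzian form and null vectors\<close>

lemma vector_4 [simp]:
  "(vector [a, b, c, d] :: 'a::zero^4) $ 1 = a"
  "(vector [a, b, c, d] :: 'a::zero^4) $ 2 = b"
  "(vector [a, b, c, d] :: 'a::zero^4) $ 3 = c"
  "(vector [a, b, c, d] :: 'a::zero^4) $ 4 = d"
  unfolding vector_def by simp_all

lemma det_4:
  "det (A::'a::comm_ring_1^4^4) =
    A$1$1 * (A$2$2 * (A$3$3 * A$4$4 - A$3$4 * A$4$3) - A$2$3 * (A$3$2 * A$4$4 - A$3$4 * A$4$2)
      + A$2$4 * (A$3$2 * A$4$3 - A$3$3 * A$4$2)) -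
    A$1$2 * (A$2$1 * (A$3$3 * A$4$4 - A$3$4 * A$4$3) - A$2$3 * (A$3$1 * A$4$4 - A$3$4 * A$4$1)
      + A$2$4 * (A$3$1 * A$4$3 - A$3$3 * A$4$1)) +
    A$1$3 * (A$2$1 * (A$3$2 * A$4$4 - A$3$4 * A$4$2) - A$2$2 * (A$3$1 * A$4$4 - A$3$4 * A$4$1)
      + A$2$4 * (A$3$1 * A$4$2 - A$3$2 * A$4$1)) -
    A$1$4 * (A$2$1 * (A$3$2 * A$4$3 - A$3$3 * A$4$2) - A$2$2 * (A$3$1 * A$4$3 - A$3$3 * A$4$1)
      + A$2$3 * (A$3$1 * A$4$2 - A$3$2 * A$4$1))"
proof -
  have f1: "finite {2::4, 3, 4}" "1 \<notin> {2::4, 3, 4}" by auto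
  have f2: "finite {3::4, 4}" "2 \<notin> {3::4, 4}" by auto
  have f3: "finite {4::4}" "3 \<notin> {4::4}" by auto
  show ?thesis
    unfolding det_def UNIV_4
    unfolding sum_over_permutations_insert[OF f1]
    unfolding sum_over_permutations_insert[OF f2]
    unfolding sum_over_permutations_insert[OF f3]
    unfolding permutes_sing
    by (simp add: sign_swap_id permutation_swap_id permutation_compose sign_compose sign_id swap_id_eq)
      (simp add: algebra_simps)
qed

lemma mink_linear:
  "mink (p + q) r = mink p r + mink q r" "mink (p - q) r = mink p r - mink q r"
  "mink (c *s p) r = c * mink p r"
  "mink r (p + q) = mink r p + mink r q" "mink r (p - q) = mink r p - mink r q"
  "mink r (c *s p) = c * mink r p"
  by (simp_all add: mink_def algebra_simps)

lemma mink_cvec: "mink (cvec p) (cvec q) = complex_of_real (mink p q)"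
  by (simp add: mink_def cvec_def)

text \<open>The vector \<open>Wvec a b\<close> is the image of the rank-one matrix with columns proportional to
  \<open>(a, 1)\<close> and rows proportional to \<open>(cnj b, 1)\<close>, and the quadratic form is a multiple of the
  determinant. Polarising the determinant on two rank-one matrices gives a product of two
  differences, and every inner product below is an instance of this one formula.\<close>

lemma mink_Wvec: "mink (Wvec a b) (Wvec c d) = - 2 * (a - c) * (cnj b - cnj d)"
  by (simp add: mink_def Wvec_def algebra_simps)

lemma Lvec_eq_Wvec: "Lvec x = Wvec x x"
  by (simp add: Lvec_def Wvec_def)

lemma cnj_vec_Wvec: "cnj_vec (Wvec x y) = Wvec y x"
  by (simp add: cnj_vec_def Wvec_def vec_eq_iff forall_4 algebra_simps)

definition Lreal :: "complex \<Rightarrow> real^4" where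
  "Lreal x = vector [1 + (cmod x)\<^sup>2, 2 * Re x, 2 * Im x, (cmod x)\<^sup>2 - 1]"

lemma Lvec_eq_cvec: "Lvec x = cvec (Lreal x)"
  unfolding vec_eq_iff forall_4
  by (simp add: Lvec_def cvec_def Lreal_def complex_eq_iff cmod_power2)
    (simp add: power2_eq_square)

lemma mink_Lreal: "mink (Lreal x) (Lreal y) = - 2 * (cmod (x - y))\<^sup>2"
  by (simp add: mink_def Lreal_def cmod_power2) (simp add: power2_eq_square algebra_simps)

text \<open>Inverse stereographic projection: a finite point of the celestial sphere determines its null
  line.\<close>

lemma lightlike_eq_scaled_Lreal:
  assumes "lightlike l" "l $ 1 \<noteq> l $ 4"
  shows "l = ((l $ 1 - l $ 4) / 2) *s Lreal (st l)"
proof -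
  define c where "c = l $ 1 - l $ 4"
  have c: "c \<noteq> 0" using assms(2) by (simp add: c_def)
  have "(l $ 2)\<^sup>2 + (l $ 3)\<^sup>2 = c * (l $ 1 + l $ 4)"
    using assms(1) by (simp add: lightlike_def mink_def c_def power2_eq_square algebra_simps)
  moreover have re: "Re (st l) = l $ 2 / c" and im: "Im (st l) = l $ 3 / c"
    by (simp_all add: st_def c_def)
  ultimately have "(cmod (st l))\<^sup>2 = (l $ 1 + l $ 4) / c"
    using c by (simp add: cmod_power2 power_divide flip: add_divide_distrib) (simp add: power2_eq_square)
  then show ?thesis
    unfolding vec_eq_iff forall_4 c_def[symmetric]
    using c by (simp add: Lreal_def re im field_simps) (simp add: c_def algebra_simps)
qed

lemma scaled_Lreal_future:
  assumes "l = c *s Lreal x" "future_directed l"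
  shows "c > 0" "lightlike l" "l $ 1 \<noteq> l $ 4" "st l = x"
proof -
  have "0 < 1 + (cmod x)\<^sup>2" by (simp add: add_pos_nonneg)
  then show c: "c > 0"
    using assms by (simp add: future_directed_def Lreal_def zero_less_mult_iff)
  have l: "mink l l = 0"
    using mink_Lreal[of x x] by (simp add: assms(1) mink_linear)
  then show "lightlike l"
    using assms(2) by (auto simp: lightlike_def future_directed_def)
  have "l $ 1 - l $ 4 = 2 * c"
    by (simp add: assms(1) Lreal_def algebra_simps)
  then show "l $ 1 \<noteq> l $ 4" "st l = x"
    using c by (auto simp: st_def complex_eq_iff assms(1) Lreal_def)
qed

text \<open>A null vector in the plane of two null lines is on one of them; its projection tells which. The
  coefficient \<open>q\<close> is read off by pairing with \<open>Lreal x\<close>, which is null but not orthogonal to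
  \<open>Lreal y\<close>.\<close>

lemma coefficient_eq_0_of_st:
  assumes "l = p *s Lreal x + q *s Lreal y" "x \<noteq> y"
    "lightlike l" "l $ 1 \<noteq> l $ 4" "st l = x"
  shows "q = 0"
proof -
  define c where "c = (l $ 1 - l $ 4) / 2"
  have "l = c *s Lreal x"
    using lightlike_eq_scaled_Lreal[OF assms(3,4)] assms(5) by (simp add: c_def)
  then have "mink l (Lreal x) = 0"
    by (simp add: mink_linear mink_Lreal)
  then show ?thesis
    using assms(2) by (simp add: assms(1) mink_linear mink_Lreal)
qed

text \<open>Orthogonality alone fixes \<open>\<nu>\<close> only up to sign; the positivity of this determinant is what
  makes the imaginary part of \<open>\<mu> W\<close>, rather than its negative, the Gauss map.\<close>

lemma det_scaled_Wvec_frame: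
  fixes F N :: "real^4"
  assumes F: "\<And>k. F $ k = Re (\<mu> * Wvec x y $ k)"
    and N: "\<And>k. N $ k = Im (\<mu> * Wvec x y $ k)"
  shows "det (vector [F, p *s Lreal x, q *s Lreal y, N] :: real^4^4) =
    2 * p * q * (cmod \<mu>)\<^sup>2 * (cmod (x - y))^4"
proof -
  define A B :: "real^4" where "A = (\<chi> k. Re (Wvec x y $ k))" and "B = (\<chi> k. Im (Wvec x y $ k))"
  \<comment> \<open>Multiplication by \<open>\<mu>\<close> acts on the plane of real and imaginary parts as a rotation
    combined with a scaling by \<open>cmod \<mu>\<close>, so the determinant picks up the square of the modulus.\<close>
  have rot: "det (vector [F, p *s Lreal x, q *s Lreal y, N] :: real^4^4) =
    p * q * (cmod \<mu>)\<^sup>2 * det (vector [A, Lreal x, Lreal y, B] :: real^4^4)"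
    by (simp add: det_4 F N A_def B_def cmod_power2) (simp add: power2_eq_square algebra_simps)
  have "(cmod (x - y))^4 = ((cmod (x - y))\<^sup>2)\<^sup>2" by simp
  also have "\<dots> = ((Re x - Re y)\<^sup>2 + (Im x - Im y)\<^sup>2)\<^sup>2" by (simp add: cmod_power2)
  finally have norm4: "(cmod (x - y))^4 = ((Re x - Re y)\<^sup>2 + (Im x - Im y)\<^sup>2)\<^sup>2" .
  have "det (vector [A, Lreal x, Lreal y, B] :: real^4^4) = 2 * (cmod (x - y))^4"
    unfolding norm4
    by (simp add: det_4 A_def B_def Lreal_def Wvec_def cmod_power2)
      (simp add: power2_eq_square algebra_simps)
  then show ?thesis by (simp add: rot)
qed

text \<open>All five products come from the fact that \<open>W\<close> and its conjugate are null, that their mutual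
  product is normalised by \<open>\<mu>\<close>, and that both are orthogonal to the two null vectors, with which
  they share an argument of \<open>Wvec\<close>.\<close>

lemma scaled_Wvec_frame_products:
  assumes F: "cvec F = (1 / 2) *s (\<mu> *s Wvec x y + cnj \<mu> *s Wvec y x)"
    and N: "cvec N = (1 / (2 * \<i>)) *s (\<mu> *s Wvec x y - cnj \<mu> *s Wvec y x)"
    and norm: "(cmod \<mu>)\<^sup>2 * (cmod (x - y))\<^sup>2 = 1"
  shows "mink F F = 1" "mink N N = 1" "mink N F = 0"
    "mink N (Lreal x) = 0" "mink N (Lreal y) = 0"
proof -
  define D where "D = mink (Wvec x y) (Wvec y x)"
  have "complex_of_real ((cmod \<mu>)\<^sup>2 * (cmod (x - y))\<^sup>2) = 1"
    unfolding norm by simp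
  moreover have "D = 2 * ((x - y) * cnj (x - y))"
    by (simp add: D_def mink_Wvec algebra_simps)
  ultimately have K: "\<mu> * cnj \<mu> * D = 2"
    unfolding of_real_mult complex_norm_square by (simp add: mult.assoc)
  have D': "mink (Wvec y x) (Wvec x y) = D" by (simp add: D_def mink_Wvec algebra_simps)
  have null: "mink (Wvec s t) (Wvec s t') = 0" "mink (Wvec s t) (Wvec s' t) = 0" for s t s' t'
    by (simp_all add: mink_Wvec)
  note expand = mink_linear D_def[symmetric] D' null
  have "complex_of_real (mink F F) = 1"
    unfolding mink_cvec[symmetric] F expand using K by (simp add: algebra_simps)
  then show "mink F F = 1" by simp
  have "complex_of_real (mink N N) = 1"
    unfolding mink_cvec[symmetric] N expand using K by (simp add: field_simps)
  then show "mink N N = 1" by simp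
  have "complex_of_real (mink N F) = 0"
    unfolding mink_cvec[symmetric] F N expand by (simp add: algebra_simps)
  then show "mink N F = 0" by simp
  have "complex_of_real (mink N (Lreal x)) = 0" "complex_of_real (mink N (Lreal y)) = 0"
    unfolding mink_cvec[symmetric] N Lvec_eq_cvec[symmetric] Lvec_eq_Wvec expand by simp_all
  then show "mink N (Lreal x) = 0" "mink N (Lreal y) = 0" by simp_all
qed

lemma independent_lightlike_pair:
  assumes "lightlike v" "mink u v \<noteq> 0"
  shows "u \<noteq> v" "independent {u, v}"
proof -
  have v: "v \<noteq> 0" "mink v v = 0" using assms(1) by (simp_all add: lightlike_def)
  then show "u \<noteq> v" using assms(2) by auto
  have "u \<notin> span {v}"
  proof
    assume "u \<in> span {v}"
    then obtain k where "u = k *s v"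
      by (auto simp: span_singleton scalar_mult_eq_scaleR)
    then show False using assms(2) v by (simp add: mink_linear)
  qed
  then show "independent {u, v}"
    using v \<open>u \<noteq> v\<close> by (simp add: independent_insert)
qed

section \<open>The derivative of the scaled frame\<close>

text \<open>The derivatives of \<open>x\<close> and \<open>y\<close> are written relative to \<open>x - y\<close> and \<open>y - x\<close>. Since
  \<open>Wvec\<close> is affine in its first argument, moving \<open>x\<close> along \<open>x - y\<close> moves \<open>W\<close> along
  \<open>Wvec x y - Wvec y y\<close>, and likewise in the second argument. This puts the derivative
  in the basis of \<open>W\<close> and the two null vectors.\<close>

lemma has_derivative_Wvec:
  assumes "(x has_derivative (\<lambda>d. a d * (x w - y w))) (at w)"
    and "(y has_derivative (\<lambda>d. b d * (y w - x w))) (at w)"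
  shows "((\<lambda>z. Wvec (x z) (y z) $ k) has_derivative
    (\<lambda>d. (a d *s (Wvec (x w) (y w) - Lvec (y w)) +
          cnj (b d) *s (Wvec (x w) (y w) - Lvec (x w))) $ k)) (at w)"
proof -
  note [derivative_intros] = assms bounded_linear.has_derivative[OF bounded_linear_cnj assms(2)]
  show ?thesis
    unfolding Wvec_def Lvec_def
    using exhaust_4[of k]
    by (elim disjE) (simp, rule has_derivative_eq_rhs, (rule derivative_intros)+,
        simp add: fun_eq_iff algebra_simps)+
qed

lemma wirtinger_Wvec:
  assumes "(x has_derivative (\<lambda>d. a d * (x w - y w))) (at w)"
    and "(y has_derivative (\<lambda>d. b d * (y w - x w))) (at w)"
  shows "dw_vec (\<lambda>z. Wvec (x z) (y z)) w =
      ((a 1 - \<i> * a \<i>) / 2) *s (Wvec (x w) (y w) - Lvec (y w)) +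
      ((cnj (b 1) - \<i> * cnj (b \<i>)) / 2) *s (Wvec (x w) (y w) - Lvec (x w))"
    and "dwbar_vec (\<lambda>z. Wvec (x z) (y z)) w =
      ((a 1 + \<i> * a \<i>) / 2) *s (Wvec (x w) (y w) - Lvec (y w)) +
      ((cnj (b 1) + \<i> * cnj (b \<i>)) / 2) *s (Wvec (x w) (y w) - Lvec (x w))"
  using frechet_derivative_at[OF has_derivative_Wvec[OF assms], symmetric]
  by (simp_all add: dw_vec_def dwbar_vec_def dw_def dwbar_def du_def dv_def vec_eq_iff field_simps)

lemma has_derivative_vec:
  assumes "\<And>k. ((\<lambda>z. f z $ k) has_derivative (\<lambda>d. f' d $ k)) (at w)"
  shows "(f has_derivative (f' :: _ \<Rightarrow> real^'n)) (at w)"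
  using assms
  by (subst has_derivative_componentwise_within) (auto simp: Basis_vec_def inner_axis)

text \<open>The hypothesis on the logarithmic derivative of \<open>\<mu>\<close> cancels exactly the \<open>W\<close>-component of
  the derivative of \<open>\<mu> W\<close>, so that what remains lies in the complex plane spanned by the two
  null vectors; these are real, hence the real part stays in their real span.\<close>

lemma frechet_derivative_Re_scaled_Wvec:
  fixes f :: "complex \<Rightarrow> real^4"
  assumes "open M" "w \<in> M"
    and f: "\<And>z k. z \<in> M \<Longrightarrow> f z $ k = Re (\<mu> z * Wvec (x z) (y z) $ k)"
    and x: "(x has_derivative (\<lambda>d. a d * (x w - y w))) (at w)"
    and y: "(y has_derivative (\<lambda>d. b d * (y w - x w))) (at w)"
    and m: "(\<mu> has_derivative m) (at w)"
    and cancel: "m d = - \<mu> w * (a d + cnj (b d))"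
  shows "frechet_derivative f (at w) d =
    (- Re (\<mu> w * cnj (b d))) *s Lreal (x w) + (- Re (\<mu> w * a d)) *s Lreal (y w)"
proof -
  define D where "D d = a d *s (Wvec (x w) (y w) - Lvec (y w)) +
    cnj (b d) *s (Wvec (x w) (y w) - Lvec (x w))" for d
  define f' :: "complex \<Rightarrow> real^4"
    where "f' d = (\<chi> k. Re (\<mu> w * D d $ k + m d * Wvec (x w) (y w) $ k))" for d
  have D: "((\<lambda>z. Wvec (x z) (y z) $ k) has_derivative (\<lambda>d. D d $ k)) (at w)" for k
    using has_derivative_Wvec[OF x y] unfolding D_def .
  have "((\<lambda>z. f z $ k) has_derivative (\<lambda>d. f' d $ k)) (at w)" for k
  proof (rule has_derivative_transform_within_open[OF _ \<open>open M\<close> \<open>w \<in> M\<close>])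
    show "((\<lambda>z. Re (\<mu> z * Wvec (x z) (y z) $ k)) has_derivative (\<lambda>d. f' d $ k)) (at w)"
      unfolding f'_def vec_lambda_beta
      by (intro bounded_linear.has_derivative[OF bounded_linear_Re] has_derivative_mult m D)
  qed (simp add: f)
  then have "frechet_derivative f (at w) = f'"
    by (metis frechet_derivative_at has_derivative_vec)
  moreover have "f' d =
      (- Re (\<mu> w * cnj (b d))) *s Lreal (x w) + (- Re (\<mu> w * a d)) *s Lreal (y w)"
    unfolding f'_def D_def cancel vec_eq_iff
    by (simp add: Lvec_eq_cvec cvec_def algebra_simps)
  ultimately show ?thesis by simp
qed

lemma smooth_on_Re_scaled_Wvec:
  fixes f :: "complex \<Rightarrow> real^4"
  assumes "open M" "smooth_on M x" "smooth_on M y" "smooth_on M \<mu>"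
    and f: "\<And>z k. z \<in> M \<Longrightarrow> f z $ k = Re (\<mu> z * Wvec (x z) (y z) $ k)"
  shows "smooth_on M f"
proof (rule smooth_on_vec[OF \<open>open M\<close>])
  fix k
  have cnj: "Ck_on n M (\<lambda>z. cnj (y z))" for n
    using assms(3) by (simp add: Ck_on_bounded_linear[OF assms(1) bounded_linear_cnj] smooth_on_def)
  have "Ck_on n M (\<lambda>z. Wvec (x z) (y z) $ k)" for n
  proof -
    have x: "Ck_on n M x" using assms(2) by (simp add: smooth_on_def)
    have "Ck_on n M (\<lambda>z. 1 + x z * cnj (y z)) \<and> Ck_on n M (\<lambda>z. x z + cnj (y z)) \<and>
      Ck_on n M (\<lambda>z. - \<i> * (x z + (- 1) * cnj (y z))) \<and> Ck_on n M (\<lambda>z. - 1 + x z * cnj (y z))"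
      by (intro conjI Ck_on_add[OF assms(1)] Ck_on_mult[OF assms(1)] Ck_on_const x cnj)
    then show ?thesis
      using exhaust_4[of k] by (elim disjE) (simp_all add: Wvec_def)
  qed
  then have "Ck_on n M (\<lambda>z. Re (\<mu> z * Wvec (x z) (y z) $ k))" for n
    using assms(4)
    by (intro Ck_on_bounded_linear[OF assms(1) bounded_linear_Re] Ck_on_mult[OF assms(1)])
      (simp_all add: smooth_on_def)
  then show "smooth_on M (\<lambda>z. f z $ k)"
    unfolding smooth_on_def using Ck_on_cong[OF assms(1)] f by (metis (no_types, lifting))
qed

text \<open>The two Wirtinger derivatives together determine the two real partial derivatives. This turns
  the conditions on \<open>\<mu>\<close> into the cancellation used above, for the directions \<open>1\<close> and \<open>\<i>\<close>.\<close>

lemma derivative_from_log_wirtinger: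
  assumes "\<mu> w \<noteq> 0" "(\<mu> has_derivative m) (at w)"
    and "dw \<mu> w / \<mu> w = - (s1 - \<i> * s2) / 2" "dwbar \<mu> w / \<mu> w = - (s1 + \<i> * s2) / 2"
  shows "m 1 = - \<mu> w * s1" "m \<i> = - \<mu> w * s2"
proof -
  have m: "frechet_derivative \<mu> (at w) = m"
    using frechet_derivative_at[OF assms(2)] by simp
  have e: "dw \<mu> w = \<mu> w * (- (s1 - \<i> * s2) / 2)" "dwbar \<mu> w = \<mu> w * (- (s1 + \<i> * s2) / 2)"
    using assms by (metis nonzero_mult_div_cancel_left times_divide_eq_right)+
  have "m 1 = dw \<mu> w + dwbar \<mu> w" "m \<i> = \<i> * (dw \<mu> w - dwbar \<mu> w)"
    by (simp_all add: dw_def dwbar_def du_def dv_def m field_simps)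
  then show "m 1 = - \<mu> w * s1" "m \<i> = - \<mu> w * s2"
    unfolding e by (simp_all add: field_simps)
qed

text \<open>The conjugate of \<open>Wvec x y\<close> is \<open>Wvec y x\<close>, so the second term of each expression is governed by
  the same derivative formula with \<open>x\<close> and \<open>y\<close> exchanged. The two terms then combine to
  a number plus its conjugate in each of the directions \<open>1\<close> and \<open>\<i>\<close>, and taking the real or
  imaginary part selects one direction.\<close>

lemma null_frame_coefficients:
  fixes f :: "complex \<Rightarrow> real^4"
  assumes "open M" "w \<in> M"
    and f: "\<And>z k. z \<in> M \<Longrightarrow> f z $ k = Re (\<mu> z * Wvec (x z) (y z) $ k)"
    and x: "(x has_derivative X) (at w)" and y: "(y has_derivative Y) (at w)"
    and m: "(\<mu> has_derivative m) (at w)" and neq: "x w \<noteq> y w" and mu: "\<mu> w \<noteq> 0"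
    and dw: "dw \<mu> w / \<mu> w = - mink (dw_vec (\<lambda>z. Wvec (x z) (y z)) w) (Wvec (y w) (x w))
      / mink (Wvec (x w) (y w)) (Wvec (y w) (x w))"
    and dwbar: "dwbar \<mu> w / \<mu> w = - mink (dwbar_vec (\<lambda>z. Wvec (x z) (y z)) w) (Wvec (y w) (x w))
      / mink (Wvec (x w) (y w)) (Wvec (y w) (x w))"
  obtains p q r s where
    "du f w = p *s Lreal (x w) + q *s Lreal (y w)"
    "dv f w = r *s Lreal (x w) + s *s Lreal (y w)"
    "Im (\<mu> w * mink (dw_vec (\<lambda>z. Wvec (x z) (y z)) w) (Lvec (y w))
           + cnj (\<mu> w) * mink (dw_vec (\<lambda>z. Wvec (y z) (x z)) w) (Lvec (y w))) =
       2 * (cmod (x w - y w))\<^sup>2 * r"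
    "Re (\<mu> w * mink (dw_vec (\<lambda>z. Wvec (x z) (y z)) w) (Lvec (x w))
           + cnj (\<mu> w) * mink (dw_vec (\<lambda>z. Wvec (y z) (x z)) w) (Lvec (x w))) =
       - 2 * (cmod (x w - y w))\<^sup>2 * q"
proof
  define a b where "a d = X d / (x w - y w)" and "b d = Y d / (y w - x w)" for d
  have X: "(x has_derivative (\<lambda>d. a d * (x w - y w))) (at w)"
    and Y: "(y has_derivative (\<lambda>d. b d * (y w - x w))) (at w)"
    using x y neq by (simp_all add: a_def b_def)
  define D where "D = complex_of_real ((cmod (x w - y w))\<^sup>2)"
  have D: "D = (x w - y w) * (cnj (x w) - cnj (y w))"
    unfolding D_def complex_norm_square by simp
  have D0: "D \<noteq> 0" using neq by (simp add: D_def)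
  note W = wirtinger_Wvec[OF X Y, unfolded Lvec_eq_Wvec]
  \<comment> \<open>Exchanging \<open>x\<close> and \<open>y\<close> also exchanges \<open>a\<close> and \<open>b\<close>.\<close>
  note W' = wirtinger_Wvec(1)[OF Y X, unfolded Lvec_eq_Wvec]
  have WW: "mink (Wvec (x w) (y w)) (Wvec (y w) (x w)) = 2 * D"
    "mink (Wvec (y w) (x w)) (Wvec (x w) (y w)) = 2 * D"
    "mink (Wvec (x w) (x w)) (Wvec (y w) (y w)) = - 2 * D"
    "mink (Wvec (y w) (y w)) (Wvec (x w) (x w)) = - 2 * D"
    by (simp_all add: mink_Wvec D algebra_simps)
  have Wo: "mink (Wvec s t) (Wvec s t') = 0" "mink (Wvec s t) (Wvec s' t) = 0" for s t s' t'
    by (simp_all add: mink_Wvec)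
  have "dw \<mu> w / \<mu> w = - ((a 1 + cnj (b 1)) - \<i> * (a \<i> + cnj (b \<i>))) / 2"
    "dwbar \<mu> w / \<mu> w = - ((a 1 + cnj (b 1)) + \<i> * (a \<i> + cnj (b \<i>))) / 2"
    unfolding dw dwbar W mink_linear WW Wo using D0 by (simp_all add: field_simps)
  note rot = derivative_from_log_wirtinger[OF mu m this]
  show "du f w = (- Re (\<mu> w * cnj (b 1))) *s Lreal (x w) + (- Re (\<mu> w * a 1)) *s Lreal (y w)"
    "dv f w = (- Re (\<mu> w * cnj (b \<i>))) *s Lreal (x w) + (- Re (\<mu> w * a \<i>)) *s Lreal (y w)"
    unfolding du_def dv_def
    by (rule frechet_derivative_Re_scaled_Wvec[OF assms(1,2) f X Y m]; simp add: rot)+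
  have "\<mu> w * mink (dw_vec (\<lambda>z. Wvec (x z) (y z)) w) (Lvec (y w))
         + cnj (\<mu> w) * mink (dw_vec (\<lambda>z. Wvec (y z) (x z)) w) (Lvec (y w)) =
      D * ((\<mu> w * cnj (b 1) + cnj (\<mu> w * cnj (b 1))) - \<i> * (\<mu> w * cnj (b \<i>) + cnj (\<mu> w * cnj (b \<i>))))"
    unfolding W W' mink_linear WW Wo Lvec_eq_Wvec by (simp add: field_simps)
  then show "Im (\<mu> w * mink (dw_vec (\<lambda>z. Wvec (x z) (y z)) w) (Lvec (y w))
           + cnj (\<mu> w) * mink (dw_vec (\<lambda>z. Wvec (y z) (x z)) w) (Lvec (y w))) =
       2 * (cmod (x w - y w))\<^sup>2 * (- Re (\<mu> w * cnj (b \<i>)))"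
    unfolding complex_add_cnj D_def by simp
  have "\<mu> w * mink (dw_vec (\<lambda>z. Wvec (x z) (y z)) w) (Lvec (x w))
         + cnj (\<mu> w) * mink (dw_vec (\<lambda>z. Wvec (y z) (x z)) w) (Lvec (x w)) =
      D * ((\<mu> w * a 1 + cnj (\<mu> w * a 1)) - \<i> * (\<mu> w * a \<i> + cnj (\<mu> w * a \<i>)))"
    unfolding W W' mink_linear WW Wo Lvec_eq_Wvec by (simp add: field_simps)
  then show "Re (\<mu> w * mink (dw_vec (\<lambda>z. Wvec (x z) (y z)) w) (Lvec (x w))
           + cnj (\<mu> w) * mink (dw_vec (\<lambda>z. Wvec (y z) (x z)) w) (Lvec (x w))) =
       - 2 * (cmod (x w - y w))\<^sup>2 * (- Re (\<mu> w * a 1))"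
    unfolding complex_add_cnj D_def by simp (simp add: algebra_simps)
qed

section \<open>The criterion\<close>

theorem lemma5p2:
  fixes M :: "complex set"
    and x y \<mu> :: "complex \<Rightarrow> complex"
    and W :: "complex \<Rightarrow> complex^4"
    and f \<nu> :: "complex \<Rightarrow> real^4"
  assumes "open M" and "connected M" and "simply_connected M"
    and "smooth_on M x" and "smooth_on M y" and "smooth_on M \<mu>"
    and "\<forall>w\<in>M. x w \<noteq> y w"
    and "W = (\<lambda>w. Wvec (x w) (y w))"
    and "\<forall>w\<in>M. complex_of_real ((cmod (\<mu> w))\<^sup>2) * mink (W w) (cnj_vec (W w)) = 2"
    and "\<forall>w\<in>M. cvec (f w) = (1 / 2) *s (\<mu> w *s W w + cnj (\<mu> w) *s cnj_vec (W w))"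
    and "\<forall>w\<in>M. cvec (\<nu> w) = (1 / (2 * \<i>)) *s (\<mu> w *s W w - cnj (\<mu> w) *s cnj_vec (W w))"
    and "\<forall>w\<in>M. dw \<mu> w / \<mu> w =
           - mink (dw_vec W w) (cnj_vec (W w)) / mink (W w) (cnj_vec (W w))"
    and "\<forall>w\<in>M. dwbar \<mu> w / \<mu> w =
           - mink (dwbar_vec W w) (cnj_vec (W w)) / mink (W w) (cnj_vec (W w))"
    and "homeo_onto_image M f"
    and "\<forall>w\<in>M. future_directed (du f w) \<and> future_directed (dv f w)"
    and "\<not> \<nu> constant_on M"
  shows "isotropic_surface M f \<and> gauss_map M f \<nu> \<and> null_directions M f x y \<longleftrightarrow>
    (\<forall>w\<in>M.
       Im (\<mu> w * mink (dw_vec W w) (Lvec (y w))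
           + cnj (\<mu> w) * mink (dw_vec (\<lambda>z. cnj_vec (W z)) w) (Lvec (y w))) = 0 \<and>
       Re (\<mu> w * mink (dw_vec W w) (Lvec (x w))
           + cnj (\<mu> w) * mink (dw_vec (\<lambda>z. cnj_vec (W z)) w) (Lvec (x w))) = 0)"
proof -
  note M = assms(1) and neq = assms(7) and W = assms(8) and norm = assms(9)
  have WW: "mink (W w) (cnj_vec (W w)) = complex_of_real (2 * (cmod (x w - y w))\<^sup>2)" for w
    unfolding W cnj_vec_Wvec mink_Wvec of_real_mult complex_norm_square
    by (simp add: algebra_simps)
  have mu: "\<mu> w \<noteq> 0" if "w \<in> M" for w
    using norm that by auto
  have f: "f w $ k = Re (\<mu> w * Wvec (x w) (y w) $ k)" if "w \<in> M" for w k
  proof -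
    have "cvec (f w) $ k = ((1 / 2) *s (\<mu> w *s W w + cnj (\<mu> w) *s cnj_vec (W w))) $ k"
      using assms(10) that by simp
    then show ?thesis
      by (simp add: cvec_def cnj_vec_def W complex_eq_iff)
  qed
  have \<nu>: "\<nu> w $ k = Im (\<mu> w * Wvec (x w) (y w) $ k)" if "w \<in> M" for w k
  proof -
    have "cvec (\<nu> w) $ k = ((1 / (2 * \<i>)) *s (\<mu> w *s W w - cnj (\<mu> w) *s cnj_vec (W w))) $ k"
      using assms(11) that by simp
    then show ?thesis
      by (simp add: cvec_def cnj_vec_def W complex_eq_iff Re_divide Im_divide field_simps)
  qed
  have cm: "(cmod (\<mu> w))\<^sup>2 * (cmod (x w - y w))\<^sup>2 = 1" if "w \<in> M" for w
  proof -
    have "complex_of_real ((cmod (\<mu> w))\<^sup>2 * (2 * (cmod (x w - y w))\<^sup>2)) = complex_of_real 2"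
      using norm that unfolding WW by (metis of_real_mult of_real_numeral)
    then show ?thesis unfolding of_real_eq_iff by simp
  qed
  have D: "\<exists>X. (h has_derivative X) (at w)"
    if "smooth_on M h" "w \<in> M" for h :: "complex \<Rightarrow> complex" and w
  proof -
    have "Ck_on (Suc 0) M h" using that(1) by (simp only: smooth_on_def)
    then show ?thesis using that(2) by (simp add: differentiable_def)
  qed
  let ?EY = "\<lambda>w. Im (\<mu> w * mink (dw_vec W w) (Lvec (y w))
           + cnj (\<mu> w) * mink (dw_vec (\<lambda>z. cnj_vec (W z)) w) (Lvec (y w)))"
  let ?EX = "\<lambda>w. Re (\<mu> w * mink (dw_vec W w) (Lvec (x w))
           + cnj (\<mu> w) * mink (dw_vec (\<lambda>z. cnj_vec (W z)) w) (Lvec (x w)))"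
  have frame: "\<exists>p q r s. du f w = p *s Lreal (x w) + q *s Lreal (y w) \<and>
      dv f w = r *s Lreal (x w) + s *s Lreal (y w) \<and>
      (?EY w = 0 \<longleftrightarrow> r = 0) \<and> (?EX w = 0 \<longleftrightarrow> q = 0)"
    if w: "w \<in> M" for w
  proof -
    obtain X Y m where "(x has_derivative X) (at w)" "(y has_derivative Y) (at w)"
      "(\<mu> has_derivative m) (at w)"
      using D assms(4-6) w by meson
    then obtain p q r s where
      "du f w = p *s Lreal (x w) + q *s Lreal (y w)"
      "dv f w = r *s Lreal (x w) + s *s Lreal (y w)"
      "?EY w = 2 * (cmod (x w - y w))\<^sup>2 * r" "?EX w = - 2 * (cmod (x w - y w))\<^sup>2 * q"
      unfolding W cnj_vec_Wvec
      using null_frame_coefficients[of M w f \<mu> x y X Y m] M w f neq mu[OF w] assms(12,13)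
      unfolding W cnj_vec_Wvec by blast
    then show ?thesis using neq w by force
  qed
  show ?thesis
  proof
    assume L: "isotropic_surface M f \<and> gauss_map M f \<nu> \<and> null_directions M f x y"
    show "\<forall>w\<in>M. ?EY w = 0 \<and> ?EX w = 0"
    proof
      fix w assume w: "w \<in> M"
      from frame[OF w] obtain p q r s where
        u: "du f w = p *s Lreal (x w) + q *s Lreal (y w)" and
        v: "dv f w = r *s Lreal (x w) + s *s Lreal (y w)" and
        E: "?EY w = 0 \<longleftrightarrow> r = 0" "?EX w = 0 \<longleftrightarrow> q = 0" by blast
      have xy: "x w \<noteq> y w" using neq w by blast
      have "q = 0"
        using L w by (intro coefficient_eq_0_of_st[OF u xy])
          (auto simp: isotropic_surface_def null_directions_def)
      moreover have "r = 0"
        using L w v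
        by (intro coefficient_eq_0_of_st[of "dv f w" s "y w" r "x w"] xy[symmetric])
          (auto simp: isotropic_surface_def null_directions_def add.commute)
      ultimately show "?EY w = 0 \<and> ?EX w = 0" using E by blast
    qed
  next
    assume R: "\<forall>w\<in>M. ?EY w = 0 \<and> ?EX w = 0"
    have null: "\<exists>p s. du f w = p *s Lreal (x w) \<and> dv f w = s *s Lreal (y w) \<and> p > 0 \<and> s > 0 \<and>
       lightlike (du f w) \<and> du f w $ 1 \<noteq> du f w $ 4 \<and> st (du f w) = x w \<and>
       lightlike (dv f w) \<and> dv f w $ 1 \<noteq> dv f w $ 4 \<and> st (dv f w) = y w" if w: "w \<in> M" for w
    proof -
      from frame[OF w] R w obtain p s where uv: "du f w = p *s Lreal (x w)" "dv f w = s *s Lreal (y w)"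
        by fastforce
      have fut: "future_directed (du f w)" "future_directed (dv f w)" using assms(15) w by auto
      show ?thesis
        using scaled_Lreal_future[OF uv(1) fut(1)] scaled_Lreal_future[OF uv(2) fut(2)] uv by blast
    qed
    have pt: "du f w \<noteq> dv f w \<and> independent {du f w, dv f w} \<and> mink (f w) (f w) = 1 \<and>
        mink (du f w) (dv f w) < 0 \<and>
        mink (\<nu> w) (\<nu> w) = 1 \<and>
        mink (\<nu> w) (f w) = 0 \<and> mink (\<nu> w) (du f w) = 0 \<and> mink (\<nu> w) (dv f w) = 0 \<and>
        det (vector [f w, du f w, dv f w, \<nu> w] :: real^4^4) > 0" if w: "w \<in> M" for w
    proof -
      from null[OF w] obtain p s where uv: "du f w = p *s Lreal (x w)" "dv f w = s *s Lreal (y w)"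
        "p > 0" "s > 0" by blast
      have xy: "x w \<noteq> y w" using neq w by blast
      have "mink (du f w) (dv f w) = p * s * (- 2 * (cmod (x w - y w))\<^sup>2)"
        by (simp add: uv mink_linear mink_Lreal)
      also have "\<dots> < 0" using uv xy by (simp add: mult_pos_neg)
      finally have neg: "mink (du f w) (dv f w) < 0" .
      have det: "det (vector [f w, du f w, dv f w, \<nu> w] :: real^4^4) > 0"
        unfolding uv det_scaled_Wvec_frame[OF f[OF w] \<nu>[OF w]] using uv mu[OF w] xy by simp
      have ind: "du f w \<noteq> dv f w" "independent {du f w, dv f w}"
        using independent_lightlike_pair[of "dv f w" "du f w"] null[OF w] neg by auto
      have "cvec (f w) = (1 / 2) *s (\<mu> w *s Wvec (x w) (y w) + cnj (\<mu> w) *s Wvec (y w) (x w))"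
        "cvec (\<nu> w) = (1 / (2 * \<i>)) *s
          (\<mu> w *s Wvec (x w) (y w) - cnj (\<mu> w) *s Wvec (y w) (x w))"
        using assms(10,11) w unfolding W cnj_vec_Wvec by blast+
      note prods = scaled_Wvec_frame_products[OF this cm[OF w]]
      show ?thesis using neg det ind prods by (simp add: uv mink_linear)
    qed
    show "isotropic_surface M f \<and> gauss_map M f \<nu> \<and> null_directions M f x y"
      unfolding isotropic_surface_def gauss_map_def null_directions_def
      using pt null smooth_on_Re_scaled_Wvec[OF M assms(4-6) f] assms(14,15)
      by (smt (verit, best))
  qed
qed

end
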